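(* For all positive integers $k,l$, $\operatorname{sat}_{\mathcal S}(k,l)=(k-1)(l-1)=\operatorname{ram}_{\mathcal S}(k,l)$. That is, if a finite sequence of distinct real numbers contains no increasing subsequence of length $k$ and no decreasing subsequence of length $l$, then either it is a proper subsequence of some finite sequence of distinct reals that still contains no increasing subsequence of length $k$ and no decreasing subsequence of length $l$, or its length is exactly $(k-1)(l-1)$.
   Context: Sequences consist of distinct real numbers. A sequence $S$ is $(k,l)$-saturated if it contains no increasing subsequence of length $k$ and no decreasing subsequence of length $l$, but every sequence $S'$ of distinct reals containing $S$ as a proper subsequence contains an increasing subsequence of length $k$ or a decreasing subsequence of length $l$. $\operatorname{sat}_{\mathcal S}(k,l)$ (resp. $\operatorname{ram}_{\mathcal S}(k,l)$) is the minimum (resp. maximum) length of a $(k,l)$-saturated sequence. *)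

theory Defs
  imports Complex_Main "HOL-Library.Sublist"
begin

definition has_inc_subseq :: "nat \<Rightarrow> real list \<Rightarrow> bool" where
  "has_inc_subseq k S \<longleftrightarrow> (\<exists>T. subseq T S \<and> length T = k \<and> sorted_wrt (<) T)"

definition has_dec_subseq :: "nat \<Rightarrow> real list \<Rightarrow> bool" where
  "has_dec_subseq l S \<longleftrightarrow> (\<exists>T. subseq T S \<and> length T = l \<and> sorted_wrt (>) T)"

definition seq_saturated :: "nat \<Rightarrow> nat \<Rightarrow> real list \<Rightarrow> bool" where
  "seq_saturated k l S \<longleftrightarrow>
     distinct S \<and> \<not> has_inc_subseq k S \<and> \<not> has_dec_subseq l S \<and>
     (\<forall>S'. distinct S' \<and> strict_subseq S S' \<longrightarrow> has_inc_subseq k S' \<or> has_dec_subseq l S')"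

(* LEAST and GREATEST are meaningful only once a saturated sequence is known to exist
   (and, for GREATEST, once the lengths are bounded). *)

definition sat_seq :: "nat \<Rightarrow> nat \<Rightarrow> nat" where
  "sat_seq k l = (LEAST n. \<exists>S. seq_saturated k l S \<and> length S = n)"

definition ram_seq :: "nat \<Rightarrow> nat \<Rightarrow> nat" where
  "ram_seq k l = (GREATEST n. \<exists>S. seq_saturated k l S \<and> length S = n)"

end

theory Submission
  imports Defs
begin

text \<open>
  Write \<open>K = k - 1\<close>, \<open>L = l - 1\<close>, and suppose that no point can be inserted into the sequence \<open>S\<close>
  without creating an increasing subsequence of length \<open>k\<close> or a decreasing one of length \<open>l\<close>.
  Fix \<open>1 \<le> i \<le> K\<close> and \<open>1 \<le> j \<le> L\<close>. Then for every place \<open>(c, y)\<close> (position \<open>c\<close>, value just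
  above \<open>y\<close>) one of four regions contains it: \<open>U\<close> (there is an increasing chain of length \<open>i\<close> to
  the lower left), \<open>V\<close> (one of length \<open>k - i\<close> to the upper right), \<open>U'\<close> (a decreasing chain of
  length \<open>j\<close> to the upper left), \<open>V'\<close> (one of length \<open>l - j\<close> to the lower right).
  The regions \<open>U\<close> and \<open>V\<close> do not meet, nor do they share an edge, since the two chains could be
  concatenated; the same holds for \<open>U'\<close> and \<open>V'\<close>. Hence every column is covered by \<open>V\<close> and \<open>V'\<close>
  or by \<open>U\<close> and \<open>U'\<close>. The leftmost column is of the first kind, the rightmost of the second, and
  where the kind changes all four regions meet in a corner. There, an entry of \<open>S\<close> has to be
  the \<open>i\<close>-th element of an increasing chain of length \<open>K\<close> and the \<open>j\<close>-th element of a decreasing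
  chain of length \<open>L\<close>. An entry determines its pair \<open>(i, j)\<close>, so \<open>S\<close> has at least \<open>K L\<close> entries.
  The theorem of Erdos and Szekeres gives the opposite inequality.
\<close>

definition chains_lt :: "('a \<Rightarrow> 'a \<Rightarrow> bool) \<Rightarrow> nat \<Rightarrow> 'a list \<Rightarrow> bool" where
  "chains_lt R k S \<longleftrightarrow> (\<forall>T. subseq T S \<longrightarrow> sorted_wrt R T \<longrightarrow> length T < k)"

text \<open>The number \<open>c\<close> is a cut between entries. The value set is a parameter so
  that \<open>{..y}\<close> with \<open><\<close> and \<open>{y<..}\<close> with \<open>>\<close>
  share one theory; \<open>i\<close> is only a lower bound on the length, so longer chains need no
  truncation.\<close>

definition before :: "('a \<Rightarrow> 'a \<Rightarrow> bool) \<Rightarrow> 'a set \<Rightarrow> nat \<Rightarrow> nat \<Rightarrow> 'a list \<Rightarrow> bool" where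
  "before R A i c S \<longleftrightarrow>
     (\<exists>T. subseq T (take c S) \<and> sorted_wrt R T \<and> set T \<subseteq> A \<and> i \<le> length T)"

definition after :: "('a \<Rightarrow> 'a \<Rightarrow> bool) \<Rightarrow> 'a set \<Rightarrow> nat \<Rightarrow> nat \<Rightarrow> 'a list \<Rightarrow> bool" where
  "after R B m c S \<longleftrightarrow>
     (\<exists>T. subseq T (drop c S) \<and> sorted_wrt R T \<and> set T \<subseteq> B \<and> m \<le> length T)"

text \<open>The entry \<open>S ! c\<close> is the \<open>i\<close>-th element of a chain of length \<open>k - 1\<close>.\<close>
definition chain_through :: "('a \<Rightarrow> 'a \<Rightarrow> bool) \<Rightarrow> nat \<Rightarrow> 'a list \<Rightarrow> nat \<Rightarrow> nat \<Rightarrow> bool" where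
  "chain_through R k S c i \<longleftrightarrow>
     (\<exists>T1 T2. subseq T1 (take c S) \<and> sorted_wrt R (T1 @ [S ! c]) \<and> i \<le> Suc (length T1) \<and>
              subseq T2 (drop (Suc c) S) \<and> sorted_wrt R (S ! c # T2) \<and> k \<le> i + Suc (length T2))"

section \<open>Subsequences and bounded chain length\<close>

lemma subseq_set_subset: "subseq T S \<Longrightarrow> set T \<subseteq> set S"
  by (auto dest: list_emb_set)

lemma subseq_distinct: "subseq T S \<Longrightarrow> distinct S \<Longrightarrow> distinct T"
  by (induction rule: list_emb.induct) (auto dest: list_emb_set)

lemma subseq_snocE:
  assumes "subseq T (xs @ [x])"
  obtains "subseq T xs" | T' where "T = T' @ [x]" "subseq T' xs"
proof -
  from assms obtain T1 T2 where T: "T = T1 @ T2" "subseq T1 xs" "subseq T2 [x]"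
    by (auto elim: subseq_appendE)
  then have "T2 = [] \<or> T2 = [x]"
    by (cases T2) (auto split: if_splits)
  then show ?thesis using T that by auto
qed

lemma subseq_ConsE:
  assumes "subseq T (x # xs)"
  obtains "subseq T xs" | T' where "T = x # T'" "subseq T' xs"
  using assms by cases auto

lemma subseq_insertE:
  assumes "subseq T (xs @ y # ys)"
  obtains "subseq T (xs @ ys)" |
    T1 T2 where "T = T1 @ y # T2" "subseq T1 xs" "subseq T2 ys"
proof -
  from assms obtain T1 T2 where T: "T = T1 @ T2" "subseq T1 xs" "subseq T2 (y # ys)"
    by (auto elim: subseq_appendE)
  from T(3) show ?thesis
  proof (cases rule: subseq_ConsE)
    case 1
    then show ?thesis using T that(1) by (simp add: list_emb_append_mono)
  next
    case (2 T')
    then show ?thesis using T that(2) by simp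
  qed
qed

lemma sorted_wrt_take_imp: "sorted_wrt R T \<Longrightarrow> sorted_wrt R (take n T)"
  by (metis append_take_drop_id sorted_wrt_append)

lemma chains_lt_iff:
  "chains_lt R k S \<longleftrightarrow> \<not> (\<exists>T. subseq T S \<and> length T = k \<and> sorted_wrt R T)"
proof -
  have "\<exists>T'. subseq T' S \<and> length T' = k \<and> sorted_wrt R T'"
    if "subseq T S" "sorted_wrt R T" "k \<le> length T" for T
  proof -
    have "subseq (take k T) S"
      by (rule subseq_order.trans[OF prefix_imp_subseq[OF take_is_prefix] that(1)])
    then show ?thesis
      using that by (intro exI[of _ "take k T"]) (simp add: sorted_wrt_take_imp)
  qed
  then have "length T < k"
    if "subseq T S" "sorted_wrt R T" "\<nexists>T. subseq T S \<and> length T = k \<and> sorted_wrt R T" for T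
    using that linorder_not_le by blast
  then show ?thesis unfolding chains_lt_def by auto
qed

lemma not_has_inc_subseq_iff: "\<not> has_inc_subseq k S \<longleftrightarrow> chains_lt (<) k S"
  by (simp add: chains_lt_iff has_inc_subseq_def)

lemma not_has_dec_subseq_iff: "\<not> has_dec_subseq l S \<longleftrightarrow> chains_lt (>) l S"
  by (simp add: chains_lt_iff has_dec_subseq_def)

section \<open>Chains on the two sides of a cut\<close>

lemma chain_concat:
  assumes "distinct S" "subseq (T1 @ T2) S" "sorted_wrt R T1" "sorted_wrt R T2"
    and "\<And>a b. a \<in> set T1 \<Longrightarrow> b \<in> set T2 \<Longrightarrow> a \<noteq> b \<Longrightarrow> R a b"
    and "chains_lt R k S"
  shows "length T1 + length T2 < k"
proof -
  \<comment> \<open>The cross condition covers only unequal values, because the value sets used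
    later, \<open>{..t}\<close> and \<open>{y<..}\<close>, may share \<open>t\<close>. Distinctness
    of \<open>S\<close> supplies the inequality.\<close>
  have "distinct (T1 @ T2)"
    using assms(1,2) subseq_distinct by blast
  then have "sorted_wrt R (T1 @ T2)"
    using assms(3-5) by (auto simp: sorted_wrt_append)
  then show ?thesis
    using assms(2,6) unfolding chains_lt_def by fastforce
qed

lemma before_after_exclusive:
  assumes "distinct S" "chains_lt R k S" "i \<le> k"
    and "before R A i c S" "after R B (k - i) c S"
    and cross: "\<And>a b. a \<in> A \<Longrightarrow> b \<in> B \<Longrightarrow> a \<in> set S \<Longrightarrow> b \<in> set S \<Longrightarrow> a \<noteq> b \<Longrightarrow> R a b"
  shows False
proof -
  obtain T1 where T1: "subseq T1 (take c S)" "sorted_wrt R T1" "set T1 \<subseteq> A" "i \<le> length T1"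
    using assms(4) unfolding before_def by blast
  obtain T2 where T2: "subseq T2 (drop c S)" "sorted_wrt R T2" "set T2 \<subseteq> B" "k - i \<le> length T2"
    using assms(5) unfolding after_def by blast
  have sub: "subseq (T1 @ T2) S"
    using list_emb_append_mono[OF T1(1) T2(1)] by simp
  have "length T1 + length T2 < k"
    using assms(1) sub T1(2) T2(2) _ assms(2)
  proof (rule chain_concat)
    show "R a b" if "a \<in> set T1" "b \<in> set T2" "a \<noteq> b" for a b
      using that subseq_set_subset[OF sub] T1(3) T2(3) by (intro cross) auto
  qed
  then show False using T1(4) T2(4) assms(3) by linarith
qed

text \<open>Only the entry \<open>S ! c\<close> separates the cuts \<open>c\<close> and
  \<open>Suc c\<close>. If one of the chains avoided it, both would lie on opposite sides of a
  single cut, which is excluded. So it ends the first chain and begins the second.\<close>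

lemma before_after_adjacent:
  assumes "distinct S" "chains_lt R k S" "i \<le> k" "c < length S"
    and "before R A i (Suc c) S" "after R B (k - i) c S"
    and cross: "\<And>a b. a \<in> A \<Longrightarrow> b \<in> B \<Longrightarrow> a \<in> set S \<Longrightarrow> b \<in> set S \<Longrightarrow> a \<noteq> b \<Longrightarrow> R a b"
  shows "S ! c \<in> A \<inter> B \<and> chain_through R k S c i"
proof -
  obtain T1 where T1: "subseq T1 (take (Suc c) S)" "sorted_wrt R T1" "set T1 \<subseteq> A" "i \<le> length T1"
    using assms(5) unfolding before_def by blast
  obtain T2 where T2: "subseq T2 (drop c S)" "sorted_wrt R T2" "set T2 \<subseteq> B" "k - i \<le> length T2"
    using assms(6) unfolding after_def by blast
  have nsub1: "\<not> subseq T1 (take c S)"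
    using before_after_exclusive[OF assms(1-3) _ assms(6) cross] T1 unfolding before_def by blast
  have nsub2: "\<not> subseq T2 (drop (Suc c) S)"
    using before_after_exclusive[OF assms(1-3,5) _ cross] T2 unfolding after_def by blast
  obtain T1' where T1': "T1 = T1' @ [S ! c]" "subseq T1' (take c S)"
    using T1(1) nsub1 assms(4) by (auto simp: take_Suc_conv_app_nth elim: subseq_snocE)
  obtain T2' where T2': "T2 = S ! c # T2'" "subseq T2' (drop (Suc c) S)"
    using T2(1) nsub2 by (auto simp flip: Cons_nth_drop_Suc[OF assms(4)] elim: subseq_ConsE)
  have "chain_through R k S c i"
    unfolding chain_through_def
    using T1 T2 T1' T2' by (intro exI[of _ T1'] exI[of _ T2']) auto
  then show ?thesis
    using T1(3) T2(3) T1'(1) T2'(1) by simp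
qed

text \<open>Glue at \<open>S ! c\<close>: at least \<open>i' - 1\<close> elements before it from one
  chain and \<open>k - 1 - i\<close> after it from the other give a chain of length at least
  \<open>k\<close> if \<open>i < i'\<close>.\<close>

lemma chain_through_less:
  assumes "transp R" "chains_lt R k S" "c < length S"
    and "chain_through R k S c i" "chain_through R k S c i'"
  shows "\<not> i < i'"
proof
  assume "i < i'"
  obtain T2 where T2: "subseq T2 (drop (Suc c) S)" "sorted_wrt R (S ! c # T2)"
      "k \<le> i + Suc (length T2)"
    using assms(4) unfolding chain_through_def by blast
  obtain T1 where T1: "subseq T1 (take c S)" "sorted_wrt R (T1 @ [S ! c])" "i' \<le> Suc (length T1)"
    using assms(5) unfolding chain_through_def by blast
  have "subseq (T1 @ S ! c # T2) S"
    using list_emb_append_mono[OF T1(1) subseq_Cons2[OF T2(1), of "S ! c"]] assms(3)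
    by (simp flip: id_take_nth_drop)
  moreover have "sorted_wrt R (T1 @ S ! c # T2)"
    using T1(2) T2(2) assms(1) by (auto simp: sorted_wrt_append dest: transpD)
  ultimately have "length (T1 @ S ! c # T2) < k"
    using assms(2) unfolding chains_lt_def by blast
  then show False using \<open>i < i'\<close> T1(3) T2(3) by simp
qed

lemma chain_through_unique:
  assumes "transp R" "chains_lt R k S" "c < length S"
    and "chain_through R k S c i" "chain_through R k S c i'"
  shows "i = i'"
  using chain_through_less[OF assms] chain_through_less[OF assms(1-3,5,4)] by simp

section \<open>Columns, and the corner where all four regions meet\<close>

lemma adjacent_levels:
  fixes X :: "real set"
  assumes "finite X" and cover: "\<And>y. P y \<or> Q y"
    and low: "\<And>y. (\<And>x. x \<in> X \<Longrightarrow> y < x) \<Longrightarrow> \<not> Q y"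
    and high: "\<And>y. (\<And>x. x \<in> X \<Longrightarrow> x \<le> y) \<Longrightarrow> \<not> P y"
  obtains y t where "P y" "Q t" "y < t" "X \<inter> {y<..<t} = {}"
proof -
  have "X \<noteq> {}"
    using cover[of 0] low[of 0] high[of 0] by auto
  then have "\<not> P (Max X)"
    using high \<open>finite X\<close> by simp
  then have "Max X \<in> {x \<in> X. Q x}"
    using cover \<open>finite X\<close> \<open>X \<noteq> {}\<close> by auto
  \<comment> \<open>Take the lowest value \<open>t\<close> of \<open>X\<close> with
    \<open>Q t\<close>, and as \<open>y\<close> the next value of \<open>X\<close> below it, or
    \<open>t - 1\<close> if there is none. Then \<open>Q y\<close> fails, so \<open>P y\<close>
    holds.\<close>
  define t where "t = Min {x \<in> X. Q x}"
  have t: "t \<in> X" "Q t" and t_le: "\<And>x. x \<in> X \<Longrightarrow> Q x \<Longrightarrow> t \<le> x"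
    using Min_in[of "{x \<in> X. Q x}"] \<open>finite X\<close> \<open>Max X \<in> _\<close> by (auto simp: t_def)
  define Y where "Y = {x \<in> X. x < t}"
  show ?thesis
  proof (cases "Y = {}")
    case True
    then have "\<not> Q (t - 1)"
      by (intro low) (force simp: Y_def)
    moreover have "X \<inter> {t - 1<..<t} = {}"
      using True by (auto simp: Y_def)
    ultimately show ?thesis
      using that[of "t - 1" t] cover[of "t - 1"] t by auto
  next
    case False
    have "finite Y" using \<open>finite X\<close> by (simp add: Y_def)
    then have "Max Y \<in> Y" using False by simp
    then have "\<not> Q (Max Y)" using t_le[of "Max Y"] by (auto simp: Y_def)
    moreover have "X \<inter> {Max Y<..<t} = {}"
      using Max_ge[OF \<open>finite Y\<close>] by (fastforce simp: Y_def)
    ultimately show ?thesis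
      using that[of "Max Y" t] cover[of "Max Y"] t \<open>Max Y \<in> Y\<close> by (auto simp: Y_def)
  qed
qed

lemma before_mono: "before R A i c S \<Longrightarrow> A \<inter> set S \<subseteq> A' \<Longrightarrow> before R A' i c S"
  unfolding before_def by (meson IntI in_set_takeD subseq_set_subset subset_iff)

lemma after_mono: "after R B m c S \<Longrightarrow> B \<inter> set S \<subseteq> B' \<Longrightarrow> after R B' m c S"
  unfolding after_def by (meson IntI in_set_dropD subseq_set_subset subset_iff)

lemma before_imp_inter:
  assumes "before R A i c S" "0 < i"
  shows "c \<noteq> 0 \<and> A \<inter> set S \<noteq> {}"
proof -
  obtain T where T: "subseq T (take c S)" "set T \<subseteq> A" "T \<noteq> []"
    using assms unfolding before_def by force
  then have "hd T \<in> A" "hd T \<in> set (take c S)"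
    using subseq_set_subset[OF T(1)] hd_in_set[OF T(3)] by blast+
  then show ?thesis by (cases c) (auto dest: in_set_takeD)
qed

lemma after_imp_inter:
  assumes "after R B m c S" "0 < m"
  shows "c < length S \<and> B \<inter> set S \<noteq> {}"
proof -
  obtain T where T: "subseq T (drop c S)" "set T \<subseteq> B" "T \<noteq> []"
    using assms unfolding after_def by force
  then have "hd T \<in> B" "hd T \<in> set (drop c S)"
    using subseq_set_subset[OF T(1)] hd_in_set[OF T(3)] by blast+
  then show ?thesis by (cases "c < length S") (auto dest: in_set_dropD)
qed

lemma entry_on_two_chains:
  fixes S :: "real list"
  assumes S: "distinct S" and inc: "chains_lt (<) k S" and dec: "chains_lt (>) l S"
    and i: "0 < i" "i < k" and j: "0 < j" "j < l"
    and cover: "\<And>c y. c \<le> length S \<Longrightarrow>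
       before (<) {..y} i c S \<or> after (<) {y<..} (k - i) c S \<or>
       before (>) {y<..} j c S \<or> after (>) {..y} (l - j) c S"
  obtains c where "c < length S" "chain_through (<) k S c i" "chain_through (>) l S c j"
proof -
  define U where "U c y \<longleftrightarrow> before (<) {..y} i c S" for c y
  define V where "V c y \<longleftrightarrow> after (<) {y<..} (k - i) c S" for c y
  define U' where "U' c y \<longleftrightarrow> before (>) {y<..} j c S" for c y
  define V' where "V' c y \<longleftrightarrow> after (>) {..y} (l - j) c S" for c y
  note defs = U_def V_def U'_def V'_def
  have cover: "U c y \<or> V c y \<or> U' c y \<or> V' c y" if "c \<le> length S" for c y
    using cover[OF that] by (simp add: defs)
  have low: "\<not> U c y" "\<not> V' c y" if "\<And>x. x \<in> set S \<Longrightarrow> y < x" for c y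
    using that before_imp_inter[of "(<)" "{..y}" i c S] after_imp_inter[of "(>)" "{..y}" "l - j" c S]
      i j by (force simp: defs)+
  have high: "\<not> U' c y" "\<not> V c y" if "\<And>x. x \<in> set S \<Longrightarrow> x \<le> y" for c y
    using that before_imp_inter[of "(>)" "{y<..}" j c S] after_imp_inter[of "(<)" "{y<..}" "k - i" c S]
      i j by (force simp: defs)+
  have left: "\<not> U 0 y" "\<not> U' 0 y" for y
    using before_imp_inter i j by (fastforce simp: defs)+
  have right: "\<not> V (length S) y" "\<not> V' (length S) y" for y
    using after_imp_inter i j by (fastforce simp: defs)+
  have column: "(\<forall>y. V c y \<or> V' c y) \<or> (\<forall>y. U c y \<or> U' c y)" if c: "c \<le> length S" for c
  proof -
    \<comment> \<open>\<open>V\<close> and \<open>U'\<close> use values above the level and fail at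
      the top; \<open>U\<close> and \<open>V'\<close> use values up to it and fail at the bottom. So
      the two pairs change over at adjacent levels.\<close>
    obtain y t where yt: "V c y \<or> U' c y" "U c t \<or> V' c t" "y < t" "set S \<inter> {y<..<t} = {}"
      by (rule adjacent_levels[of "set S" "\<lambda>y. V c y \<or> U' c y" "\<lambda>y. U c y \<or> V' c y"])
        (use cover[OF c] low high in blast)+
    have split: "v \<le> y \<or> t \<le> v" if "v \<in> set S" for v
      using that yt(4) by force
    \<comment> \<open>Every entry is at most \<open>y\<close> or at least \<open>t\<close>, so
      unequal entries from \<open>{..t}\<close> and \<open>{y<..}\<close> are always in increasing
      order.\<close>
    have "\<not> (U c t \<and> V c y)"
      using before_after_exclusive[OF S inc less_imp_le[OF i(2)], of "{..t}" c "{y<..}"] split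
      unfolding defs by force
    moreover have "\<not> (U' c y \<and> V' c t)"
      using before_after_exclusive[OF S dec less_imp_le[OF j(2)], of "{y<..}" c "{..t}"] split
      unfolding defs by force
    ultimately consider "V c y" "V' c t" | "U' c y" "U c t"
      using yt(1,2) by blast
    then show ?thesis
    proof cases
      case 1
      \<comment> \<open>As no entry lies strictly between \<open>y\<close> and \<open>t\<close>,
        \<open>V\<close> reaches every level below \<open>t\<close>, and \<open>V'\<close> every
        level from \<open>t\<close> on.\<close>
      have "V c z \<or> V' c z" for z
      proof (cases "z < t")
        case True
        then have "V c z"
          using 1(1) split unfolding V_def by (elim after_mono) force
        then show ?thesis ..
      next
        case False
        then have "V' c z"
          using 1(2) unfolding V'_def by (elim after_mono) force
        then show ?thesis ..
      qed
      then show ?thesis by blast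
    next
      case 2
      have "U c z \<or> U' c z" for z
      proof (cases "z < t")
        case True
        then have "U' c z"
          using 2(1) split unfolding U'_def by (elim before_mono) force
        then show ?thesis ..
      next
        case False
        then have "U c z"
          using 2(2) unfolding U_def by (elim before_mono) force
        then show ?thesis ..
      qed
      then show ?thesis by blast
    qed
  qed
  define col where "col c \<longleftrightarrow> (\<forall>y. V c y \<or> V' c y)" for c
  have "col 0" using column[of 0] left by (auto simp: col_def)
  moreover have "\<not> col (length S)" using right by (simp add: col_def)
  ultimately obtain c where c: "c < length S" "col c" "\<not> col (Suc c)"
    using ex_least_nat_less[of "\<lambda>n. \<not> col n" "length S"] by blast
  then have V: "V c y \<or> V' c y" and U: "U (Suc c) y \<or> U' (Suc c) y" for y
    using column[of "Suc c"] by (auto simp: col_def)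
  \<comment> \<open>A shared edge would put \<open>S ! c\<close> into both \<open>{..y}\<close> and
    \<open>{y<..}\<close>, which are disjoint.\<close>
  have "\<not> (U (Suc c) y \<and> V c y)" for y
    using before_after_adjacent[OF S inc less_imp_le[OF i(2)] c(1), of "{..y}" "{y<..}"]
    unfolding defs by auto
  moreover have "\<not> (U' (Suc c) y \<and> V' c y)" for y
    using before_after_adjacent[OF S dec less_imp_le[OF j(2)] c(1), of "{y<..}" "{..y}"]
    unfolding defs by auto
  ultimately have "V c y \<and> U' (Suc c) y \<or> V' c y \<and> U (Suc c) y" for y
    using U V by blast
  then obtain y t where yt: "V c y" "U' (Suc c) y" "V' c t" "U (Suc c) t"
      "set S \<inter> {y<..<t} = {}"
    using low high
    by (rule_tac adjacent_levels[of "set S" "\<lambda>y. V c y \<and> U' (Suc c) y"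
          "\<lambda>y. V' c y \<and> U (Suc c) y"]) blast+
  have split: "v \<le> y \<or> t \<le> v" if "v \<in> set S" for v
    using that yt(5) by force
  \<comment> \<open>At the corner the sets \<open>{..t}\<close> and \<open>{y<..}\<close> overlap,
    so a shared edge is no contradiction but yields the chain.\<close>
  have "chain_through (<) k S c i"
    using before_after_adjacent[OF S inc less_imp_le[OF i(2)] c(1), of "{..t}" "{y<..}"] split yt
    unfolding defs by force
  moreover have "chain_through (>) l S c j"
    using before_after_adjacent[OF S dec less_imp_le[OF j(2)] c(1), of "{y<..}" "{..t}"] split yt
    unfolding defs by force
  ultimately show ?thesis using that c(1) by blast
qed

section \<open>Lower bound by inserting a point\<close>

lemma chains_lt_insertD:
  assumes "chains_lt R k S" "\<not> chains_lt R k (take c S @ y # drop c S)" "i \<le> k" "0 < i"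
  shows "before R {x. R x y} i c S \<or> after R {x. R y x} (k - i) c S"
proof -
  obtain T where T: "subseq T (take c S @ y # drop c S)" "sorted_wrt R T" "k \<le> length T"
    using assms(2) unfolding chains_lt_def by (meson linorder_not_le)
  from T(1) show ?thesis
  proof (cases rule: subseq_insertE)
    case 1
    then show ?thesis using assms(1) T(2,3) unfolding chains_lt_def by fastforce
  next
    case (2 T1 T2)
    \<comment> \<open>Otherwise \<open>T\<close> has at most
      \<open>(i - 1) + 1 + (k - i - 1)\<close> elements, fewer than \<open>k\<close>.\<close>
    then have "i \<le> length T1 \<or> k - i \<le> length T2" using T(3) by auto
    then show ?thesis
      using 2 T(2) unfolding before_def after_def by (auto simp: sorted_wrt_append)
  qed
qed

lemma length_ge_of_not_extendable:
  fixes S :: "real list"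
  assumes S: "distinct S" and inc: "chains_lt (<) k S" and dec: "chains_lt (>) l S"
    and ext: "\<And>S'. distinct S' \<Longrightarrow> strict_subseq S S' \<Longrightarrow> \<not> (chains_lt (<) k S' \<and> chains_lt (>) l S')"
  shows "(k - 1) * (l - 1) \<le> length S"
proof -
  have cover: "before (<) {..y} i c S \<or> after (<) {y<..} (k - i) c S \<or>
       before (>) {y<..} j c S \<or> after (>) {..y} (l - j) c S"
    if "0 < i" "i < k" "0 < j" "j < l" for i j c y
  proof -
    \<comment> \<open>The value \<open>y + 1\<close> keeps \<open>N\<close> nonempty when no entry
      exceeds \<open>y\<close>. The new value \<open>z\<close> lies above \<open>y\<close> and below
      all larger entries.\<close>
    define N where "N = insert (y + 1) {x \<in> set S. y < x}"
    have N: "finite N" "N \<noteq> {}" "\<And>x. x \<in> N \<Longrightarrow> y < x" by (auto simp: N_def)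
    then have "y < Min N" by simp
    then obtain z where z: "y < z" "z < Min N" using dense by blast
    have above: "z < x" if "x \<in> set S" "y < x" for x
    proof -
      have "Min N \<le> x" using that N(1) by (intro Min_le) (auto simp: N_def)
      then show ?thesis using z(2) by simp
    qed
    have sides: "{x. x < z} \<inter> set S \<subseteq> {..y}" "{x. z < x} \<inter> set S \<subseteq> {y<..}"
      using above z(1) by force+
    let ?S' = "take c S @ z # drop c S"
    have "z \<notin> set S" using above z(1) by fastforce
    moreover have "distinct (take c S @ drop c S)" using S by simp
    ultimately have "distinct ?S'"
      unfolding distinct_append by (auto dest: in_set_takeD in_set_dropD)
    moreover have "subseq (take c S @ drop c S) ?S'"
      by (rule list_emb_append_mono) auto
    moreover have "S \<noteq> ?S'"
      using \<open>z \<notin> set S\<close> by (metis in_set_conv_decomp)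
    ultimately consider "\<not> chains_lt (<) k ?S'" | "\<not> chains_lt (>) l ?S'"
      using ext[of ?S'] by (auto simp: strict_subseq_def)
    then show ?thesis
    proof cases
      case 1
      then have "before (<) {x. x < z} i c S \<or> after (<) {x. z < x} (k - i) c S"
        using chains_lt_insertD[OF inc] that by simp
      then have "before (<) {..y} i c S \<or> after (<) {y<..} (k - i) c S"
        using before_mono[OF _ sides(1)] after_mono[OF _ sides(2)] by blast
      then show ?thesis by blast
    next
      case 2
      then have "before (>) {x. z < x} j c S \<or> after (>) {x. x < z} (l - j) c S"
        using chains_lt_insertD[OF dec] that by simp
      then have "before (>) {y<..} j c S \<or> after (>) {..y} (l - j) c S"
        using before_mono[OF _ sides(2)] after_mono[OF _ sides(1)] by blast
      then show ?thesis by blast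
    qed
  qed
  \<comment> \<open>Each pair of indices is related to some entry, and each entry to at most one
    pair; this bounds the number of pairs.\<close>
  let ?r = "\<lambda>p c. chain_through (<) k S c (fst p) \<and> chain_through (>) l S c (snd p)"
  have "card ({0<..<k} \<times> {0<..<l}) \<le> card {..<length S}"
  proof (rule card_le_if_inj_on_rel[where r = ?r])
    fix p assume "p \<in> {0<..<k} \<times> {0<..<l}"
    then have p: "0 < fst p" "fst p < k" "0 < snd p" "snd p < l" by auto
    obtain c where "c < length S" "?r p c"
      using entry_on_two_chains[OF S inc dec p cover[OF p]] by blast
    then show "\<exists>c. c \<in> {..<length S} \<and> ?r p c" by blast
  next
    fix p q c assume "c \<in> {..<length S}" "?r p c" "?r q c"
    then show "p = q"
      using chain_through_unique[OF transp_on_less inc, of c "fst p" "fst q"]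
        chain_through_unique[OF transp_on_greater dec, of c "snd p" "snd q"]
      by (simp add: prod_eq_iff)
  qed simp
  then show ?thesis by (simp add: card_cartesian_product)
qed

section \<open>Upper bound of Erdos and Szekeres\<close>

lemma chain_labelling:
  assumes "chains_lt R k S"
  obtains e where "\<And>c. c < length S \<Longrightarrow> e c \<in> {0<..<k}"
    and "\<And>c c'. c < c' \<Longrightarrow> c' < length S \<Longrightarrow> transp R \<Longrightarrow> R (S ! c) (S ! c') \<Longrightarrow> e c < e c'"
proof -
  define C where "C c = {T. subseq T (take c S) \<and> sorted_wrt R (T @ [S ! c])}" for c
  \<comment> \<open>The label is the length of a longest chain ending at entry \<open>c\<close>;
    \<open>Suc\<close> counts that entry.\<close>
  define e where "e c = Suc (Max (length ` C c))" for c
  have fin: "finite (length ` C c)" for c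
    by (rule finite_imageI, rule finite_subset[of _ "set (subseqs (take c S))"])
      (auto simp: C_def)
  have "[] \<in> C c" for c by (simp add: C_def)
  then have "Max (length ` C c) \<in> length ` C c" for c using fin by (intro Max_in) auto
  then have obt: "\<exists>T. T \<in> C c \<and> e c = Suc (length T)" for c unfolding e_def by force
  have snoc: "subseq (T @ [S ! c]) (take c' S)"
    if "T \<in> C c" "c < c'" "c' \<le> length S" for T c c'
  proof -
    have "subseq (T @ [S ! c]) (take (Suc c) S)"
      using that by (auto simp: C_def take_Suc_conv_app_nth)
    moreover have "prefix (take (Suc c) S) (take c' S)"
      using that take_is_prefix[of "Suc c" "take c' S"] by (simp add: min_absorb1)
    ultimately show ?thesis by (metis prefix_imp_subseq subseq_order.trans)
  qed
  show ?thesis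
  proof
    fix c assume "c < length S"
    obtain T where T: "T \<in> C c" "e c = Suc (length T)" using obt by blast
    have "subseq (T @ [S ! c]) S" using snoc[OF T(1) \<open>c < length S\<close>] by simp
    then have "length (T @ [S ! c]) < k"
      using assms T(1) unfolding chains_lt_def C_def by blast
    then show "e c \<in> {0<..<k}" using T(2) by simp
  next
    fix c c' assume cc': "c < c'" "c' < length S" "transp R" "R (S ! c) (S ! c')"
    obtain T where T: "T \<in> C c" "e c = Suc (length T)" using obt by blast
    have "sorted_wrt R ((T @ [S ! c]) @ [S ! c'])"
      using T(1) cc'(3,4) by (auto simp: C_def sorted_wrt_append dest: transpD)
    then have "T @ [S ! c] \<in> C c'"
      using snoc[OF T(1) cc'(1)] cc'(2) by (simp add: C_def)
    then have "length (T @ [S ! c]) \<le> Max (length ` C c')"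
      by (intro Max_ge fin imageI)
    then show "e c < e c'" using T(2) by (simp add: e_def)
  qed
qed

text \<open>Of two entries, the later one has the larger increasing label or the larger decreasing
  label. Hence the label pairs are distinct, and a grid of \<open>(k - 1) * (l - 1)\<close> pairs
  holds them.\<close>

theorem erdos_szekeres:
  fixes S :: "'a::linorder list"
  assumes "distinct S" "chains_lt (<) k S" "chains_lt (>) l S"
  shows "length S \<le> (k - 1) * (l - 1)"
proof -
  obtain e where e: "\<And>c. c < length S \<Longrightarrow> e c \<in> {0<..<k}"
    "\<And>c c'. c < c' \<Longrightarrow> c' < length S \<Longrightarrow> S ! c < S ! c' \<Longrightarrow> e c < e c'"
    using chain_labelling[OF assms(2)] by (metis transp_on_less)
  obtain d where d: "\<And>c. c < length S \<Longrightarrow> d c \<in> {0<..<l}"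
    "\<And>c c'. c < c' \<Longrightarrow> c' < length S \<Longrightarrow> S ! c > S ! c' \<Longrightarrow> d c < d c'"
    using chain_labelling[OF assms(3)] by (metis transp_on_greater)
  have neq: "(e c, d c) \<noteq> (e c', d c')" if "c < c'" "c' < length S" for c c'
  proof -
    have "S ! c \<noteq> S ! c'" using that assms(1) by (simp add: nth_eq_iff_index_eq)
    then show ?thesis using e(2)[OF that] d(2)[OF that] 
      by (cases "S ! c" "S ! c'" rule: linorder_cases) auto
  qed
  have "inj_on (\<lambda>c. (e c, d c)) {..<length S}"
    by (intro linorder_inj_onI) (use neq in auto)
  then have "card {..<length S} \<le> card ({0<..<k} \<times> {0<..<l})"
    by (rule card_inj_on_le) (use e(1) d(1) in auto)
  then show ?thesis by (simp add: card_cartesian_product)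
qed

section \<open>Saturated sequences\<close>

lemma seq_saturated_iff:
  "seq_saturated k l S \<longleftrightarrow>
     distinct S \<and> chains_lt (<) k S \<and> chains_lt (>) l S \<and>
     (\<forall>S'. distinct S' \<and> strict_subseq S S' \<longrightarrow> \<not> (chains_lt (<) k S' \<and> chains_lt (>) l S'))"
  unfolding seq_saturated_def not_has_inc_subseq_iff[symmetric] not_has_dec_subseq_iff[symmetric]
  by blast

lemma length_seq_saturated: "seq_saturated k l S \<Longrightarrow> length S = (k - 1) * (l - 1)"
  unfolding seq_saturated_iff
  by (intro antisym erdos_szekeres length_ge_of_not_extendable) blast+

text \<open>A longest sequence avoiding both kinds of chain is saturated; it exists because the
  empty list qualifies and the upper bound limits the lengths.\<close>

lemma ex_seq_saturated:
  assumes "k \<ge> 1" "l \<ge> 1"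
  shows "\<exists>S. seq_saturated k l S"
proof -
  let ?P = "\<lambda>S :: real list. distinct S \<and> chains_lt (<) k S \<and> chains_lt (>) l S"
  have "?P []" using assms by (fastforce simp: chains_lt_def dest: list_emb_Nil2)
  moreover have "\<forall>S. ?P S \<longrightarrow> length S < Suc ((k - 1) * (l - 1))"
    using erdos_szekeres by (auto simp: less_Suc_eq_le)
  ultimately obtain S where S: "?P S" "\<And>S'. ?P S' \<Longrightarrow> length S' \<le> length S"
    using ex_has_greatest_nat[of ?P "[]" length] by blast
  moreover have "length S < length S'" if "strict_subseq S S'" for S'
    using that by (metis le_neq_implies_less list_emb_length strict_subseq_def subseq_same_length)
  ultimately show ?thesis
    unfolding seq_saturated_iff by (meson linorder_not_le)
qed

theorem theorem5:
  fixes k l :: nat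
  assumes "k \<ge> 1" and "l \<ge> 1"
  shows "(\<exists>S. seq_saturated k l S) \<and>
         sat_seq k l = (k - 1) * (l - 1) \<and>
         ram_seq k l = (k - 1) * (l - 1) \<and>
         (\<forall>S :: real list.
            distinct S \<and> \<not> has_inc_subseq k S \<and> \<not> has_dec_subseq l S \<longrightarrow>
            (\<exists>S'. distinct S' \<and> strict_subseq S S' \<and>
                  \<not> has_inc_subseq k S' \<and> \<not> has_dec_subseq l S') \<or>
            length S = (k - 1) * (l - 1))"
proof -
  obtain S0 where S0: "seq_saturated k l S0"
    using ex_seq_saturated[OF assms] by blast
  \<comment> \<open>The set of lengths is a singleton, so \<open>LEAST\<close> and
    \<open>GREATEST\<close> both return its element.\<close>
  have "(\<exists>S. seq_saturated k l S \<and> length S = n) \<longleftrightarrow> n = (k - 1) * (l - 1)" for n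
    using S0 length_seq_saturated by blast
  then have "sat_seq k l = (k - 1) * (l - 1)" "ram_seq k l = (k - 1) * (l - 1)"
    unfolding sat_seq_def ram_seq_def by (simp_all add: Least_equality Greatest_equality)
  moreover have "(\<exists>S'. distinct S' \<and> strict_subseq S S' \<and>
      \<not> has_inc_subseq k S' \<and> \<not> has_dec_subseq l S') \<or> length S = (k - 1) * (l - 1)"
    if "distinct S \<and> \<not> has_inc_subseq k S \<and> \<not> has_dec_subseq l S" for S
    using that length_seq_saturated[of k l S] unfolding seq_saturated_def by blast
  ultimately show ?thesis using S0 by blast
qed

end
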